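(* Let $0<a<\frac13$ and let $G:\mathbb{T}^2\to\mathbb{T}^2$, $\mathbb{T}^2=\mathbb{R}^2/(2\pi\mathbb{Z})^2$, be the diffeomorphism induced by $$G(x,y)=\bigl(x+2a\sin x+a\sin y+a\sin(x-y),\; y+a\sin x+2a\sin y+a\sin(y-x)\bigr)\pmod{2\pi}.$$ Let $H_2=\{(\frac{4\pi}{3},\frac{2\pi}{3})\}$ and let $R$ be the open set $$R=\{(x,y)\in\,]0,2\pi[\,\times\,]0,2\pi[\;:\; y<x\}.$$ Then the function $$U(x,y)=|x-2y|+|2\pi+y-2x|$$ is a strict Lyapunov function for $G$ on $R$ (with respect to $H_2$), and $H_2$ is asymptotically stable for $G$.
   Context: For $0<a<\frac13$ the map $G$ is a diffeomorphism of $\mathbb{T}^2$. The set $R$ is invariant under $G$; points of $R$ and their images are represented by coordinates in $]0,2\pi[^2$. The discrete orbital derivative of $U$ is $\dot U(x,y)=U(G(x,y))-U(x,y)$. A continuous function $U$ on an open set $R$ is a Lyapunov function for $G$ on $R$ if $\dot U\le 0$ on $R$; it is a strict Lyapunov function on $R$ with respect to a compact set $H\subset R$ if in addition $U= 0$ on $H$, $U>0$ on $R\setminus H$ and $\dot U<0$ on $R\setminus H$. A compact set $H$ is Lyapunov stable if for every neighbourhood $N$ of $H$ there is a neighbourhood $W$ of $H$ such that $G^n(z)\in N$ for all $z\in W$, $n\ge 0$; it is asymptotically stable if it is Lyapunov stable and there is a neighbourhood of $H$ all of whose points $z$ satisfy $\operatorname{dist}(G^n(z),H)\to 0$ as $n\to+\infty$.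 *)

theory Defs
  imports "HOL-Analysis.Analysis" "HOL-Library.Real_Mod"
begin

definition torus_rel :: "real \<times> real \<Rightarrow> real \<times> real \<Rightarrow> bool" where
  "torus_rel u v \<longleftrightarrow>
     [fst u = fst v] (rmod (2 * pi)) \<and> [snd u = snd v] (rmod (2 * pi))"

quotient_type torus = "real \<times> real" / torus_rel
  morphisms rep_torus torus_proj
  by (auto intro!: equivpI reflpI sympI transpI simp: torus_rel_def rcong_def)

lemma torus_proj_eq_iff: "torus_proj u = torus_proj v \<longleftrightarrow> torus_rel u v"
  by (rule torus.abs_eq_iff)

lemma torus_proj_rep [simp]: "torus_proj (rep_torus p) = p"
  by (rule Quotient_abs_rep[OF Quotient_torus])

lemma torus_rel_altdef:
  "torus_rel u v \<longleftrightarrow> (\<exists>m n :: int. v = u + (of_int m * (2 * pi), of_int n * (2 * pi)))"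
  by (auto simp: torus_rel_def rcong_altdef prod_eq_iff)

lemma closed_torus_fibre: "closed (torus_proj -` {p})"
proof -
  have "torus_proj -` {p} =
      {u. cis (fst u) = cis (fst (rep_torus p)) \<and> cis (snd u) = cis (snd (rep_torus p))}"
    using torus_proj_eq_iff[of _ "rep_torus p"] by (auto simp: torus_rel_def cis_eq_iff)
  also have "closed \<dots>"
    by (intro closed_Collect_conj closed_Collect_eq) (auto intro!: continuous_intros)
  finally show ?thesis .
qed

instantiation torus :: metric_space
begin

text \<open>The distance of two points is the distance of their fibres (cosets of
  \<open>(2\<pi>\<int>)\<^sup>2\<close>) for the Euclidean distance of the plane.\<close>

definition dist_torus :: "torus \<Rightarrow> torus \<Rightarrow> real" where
  "dist_torus p q = setdist (torus_proj -` {p}) (torus_proj -` {q})"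

definition uniformity_torus :: "(torus \<times> torus) filter" where
  "uniformity_torus = (INF e\<in>{0<..}. principal {(x, y). dist x y < e})"

definition open_torus :: "torus set \<Rightarrow> bool" where
  "open_torus S \<longleftrightarrow> (\<forall>x\<in>S. \<forall>\<^sub>F (x', y) in uniformity. x' = x \<longrightarrow> y \<in> S)"

lemma torus_fibre_nonempty: "torus_proj -` {p} \<noteq> {}"
  using torus_proj_rep[of p] by blast

lemma dist_torus_proj_le: "dist (torus_proj u) (torus_proj v) \<le> dist u v"
  unfolding dist_torus_def by (rule setdist_le_dist) auto

lemma dist_torus_eq_infdist:
  "dist (torus_proj u) q = infdist u (torus_proj -` {q})"
proof (rule antisym)
  have "infdist u (torus_proj -` {q}) = setdist {u} (torus_proj -` {q})"
    by (simp add: infdist_eq_setdist)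
  thus "dist (torus_proj u) q \<le> infdist u (torus_proj -` {q})"
    unfolding dist_torus_def by (auto intro!: setdist_subset_left)
next
  show "infdist u (torus_proj -` {q}) \<le> dist (torus_proj u) q"
    unfolding dist_torus_def
  proof (subst le_setdist_iff, intro conjI ballI impI)
    fix x y assume x: "x \<in> torus_proj -` {torus_proj u}" and y: "y \<in> torus_proj -` {q}"
    then obtain m n :: int where mn: "u = x + (of_int m * (2 * pi), of_int n * (2 * pi))"
      by (auto simp: torus_proj_eq_iff torus_rel_altdef)
    define y' where "y' = y + (of_int m * (2 * pi), of_int n * (2 * pi))"
    have "torus_rel y y'"
      unfolding torus_rel_altdef y'_def by blast
    hence "torus_proj y = torus_proj y'"
      by (simp only: torus_proj_eq_iff)
    hence "y' \<in> torus_proj -` {q}" using y by auto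
    hence "infdist u (torus_proj -` {q}) \<le> dist u y'" by (rule infdist_le)
    also have "dist u y' = dist x y" unfolding mn y'_def by simp
    finally show "infdist u (torus_proj -` {q}) \<le> dist x y" .
  qed (use torus_fibre_nonempty in auto)
qed

lemma dist_torus_attained:
  obtains v where "torus_proj v = q" "dist (torus_proj u) q = dist u v"
  using infdist_attains_inf[OF closed_torus_fibre torus_fibre_nonempty, of q u]
  by (auto simp: dist_torus_eq_infdist)

instance
proof
  fix p q r :: torus
  have comm: "dist p q = dist q p" for p q :: torus
    unfolding dist_torus_def by (rule setdist_sym)
  have tri: "dist p q \<le> dist p r + dist r q"
  proof -
    obtain v where v: "torus_proj v = r" "dist p r = dist (rep_torus p) v"
      using dist_torus_attained[of r "rep_torus p"] by auto
    obtain w where w: "torus_proj w = q" "dist r q = dist v w"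
      using dist_torus_attained[of q v] v by auto
    have "dist p q \<le> dist (rep_torus p) w"
      using dist_torus_proj_le[of "rep_torus p" w] w by simp
    also have "\<dots> \<le> dist (rep_torus p) v + dist v w" by (rule dist_triangle)
    finally show ?thesis using v w by simp
  qed
  show "dist p q \<le> dist p r + dist q r" using tri comm[of q r] by simp
  show "dist p q = 0 \<longleftrightarrow> p = q"
  proof
    assume 0: "dist p q = 0"
    obtain w where "torus_proj w = q" "dist p q = dist (rep_torus p) w"
      using dist_torus_attained[of q "rep_torus p"] by auto
    thus "p = q" using 0 by auto
  next
    assume "p = q"
    thus "dist p q = 0"
      using dist_torus_proj_le[of "rep_torus p" "rep_torus p"]
      by (simp add: dist_torus_def setdist_pos_le antisym)
  qed
qed (simp_all add: uniformity_torus_def open_torus_def)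

end

text \<open>The metric topology is the quotient topology.\<close>

lemma continuous_on_torus_proj: "continuous_on S torus_proj"
  unfolding continuous_on_iff using dist_torus_proj_le order.strict_trans1 by blast

lemma open_torus_iff: "open S \<longleftrightarrow> open (torus_proj -` S)"
proof
  assume "open S"
  thus "open (torus_proj -` S)"
    using continuous_on_torus_proj[of UNIV] by (rule open_vimage)
next
  assume op: "open (torus_proj -` S)"
  show "open S"
    unfolding open_dist
  proof
    fix p assume "p \<in> S"
    hence "rep_torus p \<in> torus_proj -` S" by simp
    then obtain e where e: "e > 0" "\<And>v. dist v (rep_torus p) < e \<Longrightarrow> torus_proj v \<in> S"
      using op unfolding open_dist by blast
    have "q \<in> S" if "dist q p < e" for q
    proof -
      obtain w where "torus_proj w = q" "dist p q = dist (rep_torus p) w"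
        using dist_torus_attained[of q "rep_torus p"] by auto
      thus ?thesis using e(2)[of w] that by (simp add: dist_commute)
    qed
    thus "\<exists>e>0. \<forall>q. dist q p < e \<longrightarrow> q \<in> S" using e(1) by blast
  qed
qed

text \<open>The representative in \<open>[0, 2\<pi>[ \<times> [0, 2\<pi>[\<close>.\<close>

lift_definition torus_coords :: "torus \<Rightarrow> real \<times> real" is
  "\<lambda>(x, y). (x rmod (2 * pi), y rmod (2 * pi))"
  by (auto simp: torus_rel_def rcong_def)

lemma torus_coords_proj:
  assumes "x \<in> {0..<2 * pi}" "y \<in> {0..<2 * pi}"
  shows   "torus_coords (torus_proj (x, y)) = (x, y)"
  using assms by (simp add: torus_coords.abs_eq)

definition orbital_derivative :: "('a \<Rightarrow> 'a) \<Rightarrow> ('a \<Rightarrow> real) \<Rightarrow> 'a \<Rightarrow> real" where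
  "orbital_derivative G U z = U (G z) - U z"

definition lyapunov_function ::
  "('a :: topological_space \<Rightarrow> 'a) \<Rightarrow> 'a set \<Rightarrow> ('a \<Rightarrow> real) \<Rightarrow> bool" where
  "lyapunov_function G R U \<longleftrightarrow>
     open R \<and> continuous_on R U \<and> (\<forall>z\<in>R. orbital_derivative G U z \<le> 0)"

definition strict_lyapunov_function ::
  "('a :: topological_space \<Rightarrow> 'a) \<Rightarrow> 'a set \<Rightarrow> 'a set \<Rightarrow> ('a \<Rightarrow> real) \<Rightarrow> bool" where
  "strict_lyapunov_function G R H U \<longleftrightarrow>
     lyapunov_function G R U \<and> compact H \<and> H \<subseteq> R \<and>
     (\<forall>z\<in>H. U z = 0) \<and>
     (\<forall>z\<in>R - H. U z > 0) \<and>
     (\<forall>z\<in>R - H. orbital_derivative G U z < 0)"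

definition neighbourhood :: "'a :: topological_space set \<Rightarrow> 'a set \<Rightarrow> bool" where
  "neighbourhood N H \<longleftrightarrow> (\<exists>S. open S \<and> H \<subseteq> S \<and> S \<subseteq> N)"

definition lyapunov_stable :: "('a :: topological_space \<Rightarrow> 'a) \<Rightarrow> 'a set \<Rightarrow> bool" where
  "lyapunov_stable G H \<longleftrightarrow> compact H \<and>
     (\<forall>N. neighbourhood N H \<longrightarrow>
        (\<exists>W. neighbourhood W H \<and> (\<forall>z\<in>W. \<forall>n. (G ^^ n) z \<in> N)))"

definition asymptotically_stable :: "('a :: metric_space \<Rightarrow> 'a) \<Rightarrow> 'a set \<Rightarrow> bool" where
  "asymptotically_stable G H \<longleftrightarrow> lyapunov_stable G H \<and>
     (\<exists>W. neighbourhood W H \<and> (\<forall>z\<in>W. (\<lambda>n. infdist ((G ^^ n) z) H) \<longlonglongrightarrow> 0))"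

definition G_lift :: "real \<Rightarrow> real \<times> real \<Rightarrow> real \<times> real" where
  "G_lift a = (\<lambda>(x, y).
     (x + 2 * a * sin x + a * sin y + a * sin (x - y),
      y + a * sin x + 2 * a * sin y + a * sin (y - x)))"

lift_definition G_map :: "real \<Rightarrow> torus \<Rightarrow> torus" is G_lift
proof -
  fix a :: real and u v :: "real \<times> real"
  assume uv: "torus_rel u v"
  obtain x y x' y' where [simp]: "u = (x, y)" "v = (x', y')" by (cases u, cases v)
  have xy: "[x = x'] (rmod (2 * pi))" "[y = y'] (rmod (2 * pi))"
    using uv by (auto simp: torus_rel_def)
  have "sin x = sin x'" "sin y = sin y'" "sin (x - y) = sin (x' - y')" "sin (y - x) = sin (y' - x')"
    using xy by (auto intro!: sin_rcong rcong_diff)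
  thus "torus_rel (G_lift a u) (G_lift a v)"
    using xy by (auto simp: torus_rel_def G_lift_def add.assoc intro!: rcong_add)
qed

definition H2 :: "torus set" where
  "H2 = {torus_proj (4 * pi / 3, 2 * pi / 3)}"

definition R_region :: "torus set" where
  "R_region = torus_proj ` {(x, y). x \<in> {0<..<2 * pi} \<and> y \<in> {0<..<2 * pi} \<and> y < x}"

text \<open>The formula is evaluated at the representative in \<open>[0, 2\<pi>[ \<times> [0, 2\<pi>[\<close>, so the function is
  defined (though not continuous) on the whole torus; only its values on the region matter, since
  the region is mapped into itself (lemma \<open>G_map_region\<close> below).\<close>

definition U_fun :: "torus \<Rightarrow> real" where
  "U_fun z = (case torus_coords z of (x, y) \<Rightarrow> \<bar>x - 2 * y\<bar> + \<bar>2 * pi + y - 2 * x\<bar>)"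

lemma region_aux:
  fixes a x y :: real
  assumes a: "0 < a" "a < 1/3" and xy: "0 < y" "y < x" "x < 2 * pi"
  shows "0 < y + a * sin x + 2 * a * sin y + a * sin (y - x)"
proof -
  have bnd: "sin t > - t / 2" if "t > 0" for t :: real
  proof (cases "t \<le> pi")
    case True
    have "sin t \<ge> 0" using sin_ge_zero that True by simp
    thus ?thesis using that by simp
  next
    case False
    have "sin t \<ge> -1" by simp
    moreover have "t > 2" using False pi_gt3 by linarith
    ultimately show ?thesis by linarith
  qed
  have "sin x + sin (y - x) = 2 * sin (y / 2) * cos (x - y / 2)"
    using sin_plus_sin[of x "y - x"] by (simp add: diff_divide_distrib)
  moreover have "\<bar>sin (y / 2) * cos (x - y / 2)\<bar> \<le> \<bar>y / 2\<bar> * 1"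
    unfolding abs_mult by (intro mult_mono abs_sin_le_one abs_cos_le_one abs_sin_x_le_abs_x) auto
  ultimately have "sin x + sin (y - x) \<ge> - y"
    using xy by (simp add: abs_le_iff)
  with bnd[of y] xy have *: "sin x + 2 * sin y + sin (y - x) > - 2 * y" by linarith
  have "a * (sin x + 2 * sin y + sin (y - x)) > a * (- 2 * y)"
    using * a(1) by (rule mult_strict_left_mono)
  moreover have "0 < (1 - 2 * a) * y" using a xy by (intro mult_pos_pos) auto
  moreover have "y + a * sin x + 2 * a * sin y + a * sin (y - x) =
      (1 - 2 * a) * y + (a * (sin x + 2 * sin y + sin (y - x)) - a * (- 2 * y))"
    by (simp add: algebra_simps)
  ultimately show ?thesis by linarith
qed

lemma G_map_region:
  assumes a: "0 < a" "a < 1/3"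
  shows "G_map a ` R_region \<subseteq> R_region"
proof
  fix p assume "p \<in> G_map a ` R_region"
  then obtain x y where xy: "0 < y" "y < x" "x < 2 * pi" and p: "p = torus_proj (G_lift a (x, y))"
    by (auto simp: R_region_def G_map.abs_eq)
  define X where "X = x + 2 * a * sin x + a * sin y + a * sin (x - y)"
  define Y where "Y = y + a * sin x + 2 * a * sin y + a * sin (y - x)"
  have "Y > 0" unfolding Y_def using region_aux[OF a xy] .
  have s: "sin (2 * pi - y - (2 * pi - x)) = sin (x - y)" 
          "sin (2 * pi - x - (2 * pi - y)) = sin (y - x)" by simp_all
  have "0 < (2*pi - x) + a * sin (2*pi - y) + 2 * a * sin (2*pi - x) + a * sin ((2*pi - x) - (2*pi - y))"
    using xy by (intro region_aux[OF a]) auto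
  moreover have "sin (y - x) = - sin (x - y)" using sin_minus[of "x - y"] by simp
  ultimately have "X < 2 * pi"
    unfolding X_def s by (simp add: sin_2pi_minus)
  have "Y < X"
  proof -
    have "0 < (x - y) + a * sin (2*pi - y) + 2 * a * sin (x - y) + a * sin ((x - y) - (2*pi - y))"
      using xy by (intro region_aux[OF a]) auto
    moreover have "sin ((x - y) - (2*pi - y)) = sin x"
      using sin_periodic[of "x - 2 * pi"] by simp
    moreover have "sin (2*pi - y) = - sin y" by (rule sin_2pi_minus)
    ultimately show ?thesis
      using \<open>sin (y - x) = - sin (x - y)\<close> unfolding X_def Y_def
      by (simp add: distrib_left)
  qed
  have "p = torus_proj (X, Y)" by (simp add: p G_lift_def X_def Y_def)
  thus "p \<in> R_region"
    unfolding R_region_def using \<open>Y > 0\<close> \<open>Y < X\<close> \<open>X < 2 * pi\<close> by auto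
qed

end

theory Submission
  imports Defs
begin

text \<open>In the variables \<open>p = y\<close>, \<open>q = x - y\<close>, \<open>r = 2\<pi> - x\<close> the region is the open simplex \<open>p, q, r > 0\<close>,
  \<open>p + q + r = 2\<pi>\<close>, the map is symmetric, \<open>p \<mapsto> p + a (2 sin p - sin q - sin r)\<close> and cyclically,
  and \<open>U = \<bar>q - p\<bar> + \<bar>r - q\<bar>\<close>. Since \<open>3a < 1\<close> the map preserves the order of the three variables,
  so on each order type \<open>U\<close> is the same linear form before and after one step. It decreases because
  \<open>sin s - sin t = - 2 cos (m/2) sin ((s - t)/2)\<close>, \<open>m\<close> being the third variable, so that \<open>s < t\<close>
  gives \<open>sin t < sin s\<close> as soon as \<open>m < \<pi>\<close>. Asymptotic stability follows from compactness of a
  sublevel set of \<open>U\<close>.\<close>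

section \<open>Strict Lyapunov functions and asymptotic stability\<close>

text \<open>Small values of \<open>U\<close> force nearness to \<open>H\<close>: on the compact part
  of the \<open>c\<close>-sublevel set outside \<open>N\<close>, \<open>U\<close> attains a positive
  minimum. Compactness excludes small values of \<open>U\<close> near the boundary of
  \<open>R\<close>. In \<open>d\<close>, the bound \<open>c\<close> keeps points in the compact set
  and the minimum keeps them in \<open>N\<close>.\<close>

lemma strict_lyapunov_sublevel_subset:
  fixes U :: "'a :: metric_space \<Rightarrow> real"
  assumes L: "strict_lyapunov_function G R H U"
    and c: "c > 0" and K: "compact {z \<in> R. U z \<le> c}"
    and N: "open N" "H \<subseteq> N"
  obtains d where "d > 0" "{z \<in> R. U z < d} \<subseteq> N"
proof -
  let ?S = "{z \<in> R. U z \<le> c} - N"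
  have S: "compact ?S" using K N(1) by (rule compact_diff)
  have pos: "U z > 0" if "z \<in> ?S" for z
    using L N(2) that by (auto simp: strict_lyapunov_function_def)
  show ?thesis
  proof (cases "?S = {}")
    case True
    show ?thesis by (rule that[of c]) (use True c in fastforce)+
  next
    case False
    have "continuous_on ?S U"
      using L by (auto simp: strict_lyapunov_function_def lyapunov_function_def
          intro: continuous_on_subset)
    from continuous_attains_inf[OF S False this] obtain m
      where m: "m \<in> ?S" "\<And>z. z \<in> ?S \<Longrightarrow> U m \<le> U z" by blast
    show ?thesis
    proof (rule that[of "min c (U m)"])
      show "min c (U m) > 0" using c pos[OF m(1)] by simp
      show "{z \<in> R. U z < min c (U m)} \<subseteq> N" using m(2) by fastforce
    qed
  qed
qed

text \<open>Sublevel sets of \<open>U\<close> are forward invariant and, by the previous lemma,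
  arbitrarily close to \<open>H\<close>, which gives stability. Attraction follows an invariance
  argument: \<open>U\<close> is constant along one step from any accumulation point of an orbit, so
  that point lies in \<open>H\<close> and \<open>U\<close> tends to 0 along the orbit.\<close>

lemma strict_lyapunov_imp_asymptotically_stable:
  fixes G :: "'a :: metric_space \<Rightarrow> 'a"
  assumes L: "strict_lyapunov_function G R H U"
    and inv: "G ` R \<subseteq> R" and cont: "continuous_on R G"
    and c: "c > 0" and K: "compact {z \<in> R. U z \<le> c}"
  shows "asymptotically_stable G H"
proof -
  have R: "open R" and contU: "continuous_on R U" and H: "compact H" "H \<subseteq> R"
    and U0: "\<And>z. z \<in> H \<Longrightarrow> U z = 0"
    and Upos: "\<And>z. z \<in> R \<Longrightarrow> z \<notin> H \<Longrightarrow> U z > 0"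
    and Uless: "\<And>z. z \<in> R \<Longrightarrow> z \<notin> H \<Longrightarrow> U (G z) < U z"
    and Ule: "\<And>z. z \<in> R \<Longrightarrow> U (G z) \<le> U z"
    using L by (auto simp: strict_lyapunov_function_def lyapunov_function_def
        orbital_derivative_def)
  have Unn: "U z \<ge> 0" if "z \<in> R" for z
    using U0[of z] Upos[of z] that by (cases "z \<in> H") auto
  have orbit: "(G ^^ n) z \<in> R" if "z \<in> R" for n z
    by (induction n) (use inv that in auto)
  have dec: "decseq (\<lambda>n. U ((G ^^ n) z))" if "z \<in> R" for z
    using orbit[OF that] Ule by (auto intro!: decseq_SucI)
  have Un: "U ((G ^^ n) z) \<le> U z" if "z \<in> R" for n z
    using decseqD[OF dec[OF that], of 0 n] by simp
  have nbhd: "neighbourhood {z \<in> R. U z < d} H" if "d > 0" for d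
  proof -
    have "open {z \<in> R. U z < d}"
      using continuous_on_open_vimage[OF R, of U] contU
      by (auto simp: vimage_def Int_def conj_commute dest!: spec[of _ "{..<d}"])
    moreover have "H \<subseteq> {z \<in> R. U z < d}" using U0 H(2) that by auto
    ultimately show ?thesis unfolding neighbourhood_def by blast
  qed
  have stable: "lyapunov_stable G H"
    unfolding lyapunov_stable_def
  proof (intro conjI allI impI H)
    fix N assume "neighbourhood N H"
    then obtain S where S: "open S" "H \<subseteq> S" "S \<subseteq> N" by (auto simp: neighbourhood_def)
    obtain d where d: "d > 0" "{z \<in> R. U z < d} \<subseteq> S"
      using strict_lyapunov_sublevel_subset[OF L c K S(1,2)] .
    have "(G ^^ n) z \<in> N" if "z \<in> R" "U z < d" for z n
      using orbit[OF that(1)] Un[OF that(1), of n] that d S by fastforce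
    thus "\<exists>W. neighbourhood W H \<and> (\<forall>z\<in>W. \<forall>n. (G ^^ n) z \<in> N)"
      using nbhd[OF d(1)] by blast
  qed
  have attr: "(\<lambda>n. infdist ((G ^^ n) z) H) \<longlonglongrightarrow> 0" if z: "z \<in> R" "U z < c" for z
  proof (cases "H = {}")
    \<comment> \<open>By convention \<open>infdist\<close> to the empty set is 0.\<close>
    case True
    thus ?thesis by (simp add: infdist_def)
  next
    case False
    let ?f = "\<lambda>n. (G ^^ n) z"
    have "?f n \<in> {z \<in> R. U z \<le> c}" for n
      using orbit[OF z(1)] Un[OF z(1), of n] z by auto
    hence inK: "\<forall>n. ?f n \<in> {z \<in> R. U z \<le> c}" by blast
    obtain l where l: "(\<lambda>n. U (?f n)) \<longlonglongrightarrow> l"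
      using decseq_convergent[OF dec[OF z(1)], of 0] Unn[OF orbit[OF z(1)]] by blast
    obtain p s where "p \<in> {z \<in> R. U z \<le> c}" and s: "strict_mono s" "(?f \<circ> s) \<longlonglongrightarrow> p"
      using seq_compactE[OF compact_imp_seq_compact[OF K] inK] .
    hence p: "p \<in> R" by simp
    have contUp: "isCont U p" and contGp: "isCont G p" and contUGp: "isCont U (G p)"
      using contU cont p inv by (auto simp: continuous_on_eq_continuous_at[OF R])
    have "(\<lambda>n. U (?f (s n))) \<longlonglongrightarrow> U p"
      using isCont_tendsto_compose[OF contUp s(2)] by (simp add: o_def)
    moreover have "(\<lambda>n. U (?f (s n))) \<longlonglongrightarrow> l"
      using LIMSEQ_subseq_LIMSEQ[OF l s(1)] by (simp add: o_def)
    ultimately have "U p = l" by (rule LIMSEQ_unique)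
    \<comment> \<open>These values form a subsequence of the orbit values shifted by one, so they
      share the limit \<open>l\<close>.\<close>
    have "(\<lambda>n. U (G (?f (s n)))) \<longlonglongrightarrow> U (G p)"
      using isCont_tendsto_compose[OF contUGp isCont_tendsto_compose[OF contGp s(2)]]
      by (simp add: o_def)
    moreover have "(\<lambda>n. U (G (?f (s n)))) \<longlonglongrightarrow> l"
      using LIMSEQ_subseq_LIMSEQ[OF LIMSEQ_Suc[OF l] s(1)] by (simp add: o_def)
    ultimately have "U (G p) = l" by (rule LIMSEQ_unique)
    with \<open>U p = l\<close> have "p \<in> H" using Uless[OF p] by auto
    with U0 \<open>U p = l\<close> l have lim0: "(\<lambda>n. U (?f n)) \<longlonglongrightarrow> 0" by simp
    show ?thesis
    proof (rule LIMSEQ_I)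
      fix e :: real assume e: "e > 0"
      have "open {x. infdist x H < e}"
        by (intro open_Collect_less continuous_intros)
      moreover have "H \<subseteq> {x. infdist x H < e}" using e by auto
      ultimately obtain d where d: "d > 0" "{z \<in> R. U z < d} \<subseteq> {x. infdist x H < e}"
        using strict_lyapunov_sublevel_subset[OF L c K] by blast
      obtain n0 where "\<And>n. n \<ge> n0 \<Longrightarrow> U (?f n) < d"
        using LIMSEQ_D[OF lim0 d(1)] by (metis abs_less_iff diff_zero real_norm_def)
      hence "infdist (?f n) H < e" if "n \<ge> n0" for n
        using d(2) orbit[OF z(1)] that by blast
      thus "\<exists>n0. \<forall>n\<ge>n0. norm (infdist (?f n) H - 0) < e"
        by (auto simp: infdist_nonneg)
    qed
  qed
  show ?thesis
    unfolding asymptotically_stable_def using stable attr nbhd[OF c] by blast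
qed

section \<open>Topology of the torus\<close>

text \<open>The distance on the torus is attained by representatives: a point near
  \<open>torus_proj u\<close> lifts to a point equally near \<open>u\<close>.\<close>

lemma open_torus_proj_image:
  assumes "open S"
  shows "open (torus_proj ` S)"
  unfolding open_dist
proof
  fix p assume "p \<in> torus_proj ` S"
  then obtain u where u: "u \<in> S" "p = torus_proj u" by blast
  then obtain e where e: "e > 0" "\<And>v. dist v u < e \<Longrightarrow> v \<in> S"
    using assms unfolding open_dist by blast
  have "q \<in> torus_proj ` S" if "dist q p < e" for q
  proof -
    obtain v where "torus_proj v = q" "dist p q = dist u v"
      using dist_torus_attained[of q u] u by auto
    thus ?thesis using e(2)[of v] that by (auto simp: dist_commute)
  qed
  thus "\<exists>e>0. \<forall>q. dist q p < e \<longrightarrow> q \<in> torus_proj ` S" using e(1) by blast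
qed

text \<open>Since the projection is open, its restriction to an open set is a quotient map onto its
  image, so continuity can be checked upstairs.\<close>

lemma continuous_on_torus_proj_image:
  fixes f :: "torus \<Rightarrow> 'a :: topological_space"
  assumes S: "open S" and f: "continuous_on S (\<lambda>u. f (torus_proj u))"
  shows "continuous_on (torus_proj ` S) f"
  unfolding continuous_on_open_vimage[OF open_torus_proj_image[OF S]]
proof (intro allI impI)
  fix B :: "'a set" assume "open B"
  hence "open ((\<lambda>u. f (torus_proj u)) -` B \<inter> S)"
    using f continuous_on_open_vimage[OF S] by blast
  hence "open (torus_proj ` ((\<lambda>u. f (torus_proj u)) -` B \<inter> S))"
    by (rule open_torus_proj_image)
  also have "torus_proj ` ((\<lambda>u. f (torus_proj u)) -` B \<inter> S) = f -` B \<inter> torus_proj ` S" by auto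
  finally show "open (f -` B \<inter> torus_proj ` S)" .
qed

lemma continuous_on_G_map: "continuous_on A (G_map a)"
proof -
  have "continuous_on UNIV (\<lambda>u. torus_proj (G_lift a u))"
    by (rule continuous_on_compose2[OF continuous_on_torus_proj[of UNIV]])
       (auto simp: G_lift_def split_def intro!: continuous_intros)
  hence "continuous_on (torus_proj ` UNIV) (G_map a)"
    by (intro continuous_on_torus_proj_image) (simp_all add: G_map.abs_eq)
  moreover have "torus_proj ` UNIV = UNIV" by (metis surj_def torus_proj_rep)
  ultimately show ?thesis using continuous_on_subset by fastforce
qed

section \<open>One step on the simplex\<close>

lemma sin_less_of_sum_2pi:
  fixes s t m :: real
  assumes "0 < s" "s < t" "0 < m" "m < pi" "s + t + m = 2 * pi"
  shows "sin t < sin s"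
proof -
  have "sin s - sin t = 2 * sin ((s - t) / 2) * cos ((s + t) / 2)" by (rule sin_diff_sin)
  also have "(s + t) / 2 = pi - m / 2" using assms by (simp add: field_simps)
  also have "(s - t) / 2 = - ((t - s) / 2)" by (simp add: field_simps)
  finally have "sin s - sin t = 2 * sin ((t - s) / 2) * cos (m / 2)"
    by (simp only: cos_pi_minus sin_minus)
  \<comment> \<open>The cosine is positive because \<open>m < pi\<close>, the sine because
    \<open>0 < t - s < 2 * pi\<close>.\<close>
  moreover have "2 * sin ((t - s) / 2) * cos (m / 2) > 0"
    using assms by (intro mult_pos_pos sin_gt_zero cos_gt_zero_pi) auto
  ultimately show ?thesis by linarith
qed

lemma sin_le_of_sum_2pi:
  fixes s t m :: real
  assumes "0 < s" "s \<le> t" "0 < m" "m < pi" "s + t + m = 2 * pi"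
  shows "sin t \<le> sin s"
  using sin_less_of_sum_2pi[of s t m] assms by (cases "s = t") auto

text \<open>Neither \<open>p\<close> nor \<open>r\<close> reaches \<pi>, since \<open>q\<close> is
  at least as large and the sum is 2\<pi>. Hence each of them can be compared with \<open>q\<close>,
  the other serving as third variable.\<close>

lemma simplex_max_decreases:
  fixes p q r :: real
  assumes pos: "0 < p" "0 < r" and sum: "p + q + r = 2 * pi"
    and max: "p \<le> q" "r \<le> q" and ne: "p \<noteq> q \<or> r \<noteq> q"
  shows "2 * sin q < sin p + sin r"
proof -
  have "sin q \<le> sin p" "sin q \<le> sin r"
    using sin_le_of_sum_2pi[of p q r] sin_le_of_sum_2pi[of r q p] assms by auto
  moreover have "sin q < sin p \<or> sin q < sin r"
    using sin_less_of_sum_2pi[of p q r] sin_less_of_sum_2pi[of r q p] assms by auto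
  ultimately show ?thesis by linarith
qed

lemma simplex_min_increases_aux:
  fixes p q r :: real
  assumes pos: "0 < q" "0 < p" and sum: "p + q + r = 2 * pi" and r: "pi \<le> r" and min: "q \<le> p"
  shows "sin p + sin r < 2 * sin q"
proof -
  have q: "sin q > 0" and s: "sin (p + q) \<ge> 0"
    using assms by (auto intro!: sin_gt_zero sin_ge_zero)
  have "sin p = sin (p + q) * cos q - cos (p + q) * sin q"
    using sin_diff[of "p + q" q] by simp
  also have "\<dots> \<le> sin (p + q) * 1 - (- 1) * sin q"
    using q s by (intro diff_mono mult_left_mono mult_right_mono) auto
  finally have "sin p \<le> sin (p + q) + sin q" by simp
  moreover have "r = 2 * pi - (p + q)" using sum by simp
  hence "sin r = - sin (p + q)" by (simp only: sin_2pi_minus)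
  ultimately show ?thesis using q by linarith
qed

text \<open>If \<open>p\<close> or \<open>r\<close> is at least \<pi>, the previous lemma applies,
  up to exchanging them; otherwise both comparisons with \<open>q\<close> are available.\<close>

lemma simplex_min_increases:
  fixes p q r :: real
  assumes pos: "0 < q" and sum: "p + q + r = 2 * pi"
    and min: "q \<le> p" "q \<le> r" and ne: "p \<noteq> q \<or> r \<noteq> q"
  shows "sin p + sin r < 2 * sin q"
proof -
  consider "pi \<le> r" | "pi \<le> p" | "r < pi" "p < pi" by linarith
  thus ?thesis
  proof cases
    case 1
    thus ?thesis using assms by (intro simplex_min_increases_aux) auto
  next
    case 2
    hence "sin r + sin p < 2 * sin q" using assms by (intro simplex_min_increases_aux) auto
    thus ?thesis by simp
  next
    case 3
    have "sin p \<le> sin q" "sin r \<le> sin q"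
      using sin_le_of_sum_2pi[of q p r] sin_le_of_sum_2pi[of q r p] assms 3 by auto
    moreover have "sin p < sin q \<or> sin r < sin q"
      using sin_less_of_sum_2pi[of q p r] sin_less_of_sum_2pi[of q r p] assms 3 by auto
    ultimately show ?thesis by linarith
  qed
qed

lemma abs_sin_diff_le:
  fixes s t :: real
  shows "\<bar>sin s - sin t\<bar> \<le> \<bar>s - t\<bar>"
proof -
  have "\<bar>sin s - sin t\<bar> = 2 * (\<bar>sin ((s - t) / 2)\<bar> * \<bar>cos ((s + t) / 2)\<bar>)"
    by (simp add: sin_diff_sin abs_mult)
  also have "\<dots> \<le> 2 * (\<bar>(s - t) / 2\<bar> * 1)"
    by (intro mult_left_mono mult_mono abs_sin_x_le_abs_x abs_cos_le_one) auto
  finally show ?thesis by simp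
qed

text \<open>The sine is 1-Lipschitz. With \<open>b = 3 * a\<close> this yields order preservation,
  since the new variables differ exactly as the values of \<open>t + 3 * a * sin t\<close>
  do.\<close>

lemma add_mult_sin_mono:
  fixes b s t :: real
  assumes "0 \<le> b" "b \<le> 1" "s \<le> t"
  shows "s + b * sin s \<le> t + b * sin t"
proof -
  have "b * (sin s - sin t) \<le> b * (t - s)"
    using abs_sin_diff_le[of s t] assms by (intro mult_left_mono) auto
  also have "\<dots> \<le> 1 * (t - s)" using assms by (intro mult_right_mono) auto
  finally show ?thesis by (simp add: algebra_simps)
qed

text \<open>This is \<open>region_aux\<close> at \<open>y = p\<close>,
  \<open>x = 2 * pi - r\<close>; the symmetry of the map gives the other two variables by
  permutation.\<close>

lemma simplex_step_pos:
  fixes a p q r :: real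
  assumes a: "0 < a" "a < 1/3"
    and pos: "0 < p" "0 < q" "0 < r" and sum: "p + q + r = 2 * pi"
  shows "0 < p + a * (2 * sin p - sin q - sin r)"
proof -
  have "0 < p + a * sin (2 * pi - r) + 2 * a * sin p + a * sin (p - (2 * pi - r))"
    using pos sum by (intro region_aux[OF a]) auto
  also have "p - (2 * pi - r) = - q" using sum by simp
  finally show ?thesis by (simp only: sin_2pi_minus sin_minus) (simp add: algebra_simps)
qed

lemma simplex_step_decreases:
  fixes a p q r :: real
  assumes a: "0 < a" "a < 1/3"
    and pos: "0 < p" "0 < q" "0 < r" and sum: "p + q + r = 2 * pi"
    and ne: "\<not> (p = q \<and> q = r)"
  defines "p' \<equiv> p + a * (2 * sin p - sin q - sin r)"
    and "q' \<equiv> q + a * (2 * sin q - sin p - sin r)"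
    and "r' \<equiv> r + a * (2 * sin r - sin p - sin q)"
  shows "\<bar>q' - p'\<bar> + \<bar>r' - q'\<bar> < \<bar>q - p\<bar> + \<bar>r - q\<bar>"
proof -
  have mono: "s + 3 * a * sin s \<le> t + 3 * a * sin t" if "s \<le> t" for s t
    using a that by (intro add_mult_sin_mono) auto
  have ord: "p \<le> q \<Longrightarrow> p' \<le> q'" "q \<le> p \<Longrightarrow> q' \<le> p'" "q \<le> r \<Longrightarrow> q' \<le> r'" "r \<le> q \<Longrightarrow> r' \<le> q'"
    using mono[of p q] mono[of q p] mono[of q r] mono[of r q]
    by (simp_all add: p'_def q'_def r'_def algebra_simps)
  have neg: "a * X < 0" if "X < 0" for X
    using a that by (simp add: mult_pos_neg)
  \<comment> \<open>If \<open>q\<close> is largest or smallest, the sum of absolute values is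
    \<bar>2q - p - r\<bar>; if \<open>q\<close> is in the middle, it is \<bar>r - p\<bar> and
    \<open>q < pi\<close>. The two identities give the change of these linear forms in one
    step.\<close>
  have q': "2 * q' - p' - r' = 2 * q - p - r + 3 * (a * (2 * sin q - sin p - sin r))"
    and rp': "r' - p' = r - p + 3 * (a * (sin r - sin p))"
    by (simp_all add: p'_def q'_def r'_def algebra_simps)
  consider "p \<le> q" "q \<le> r" | "r \<le> q" "q \<le> p" | "p \<le> q" "r \<le> q" | "q \<le> p" "q \<le> r" by linarith
  thus ?thesis
  proof cases
    case 1
    hence "sin r < sin p" using assms by (intro sin_less_of_sum_2pi[of _ _ q]) auto
    hence "a * (sin r - sin p) < 0" by (intro neg) simp
    thus ?thesis using ord 1 rp' by linarith
  next
    case 2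
    hence "sin p < sin r" using assms by (intro sin_less_of_sum_2pi[of _ _ q]) auto
    hence "a * (sin p - sin r) < 0" by (intro neg) simp
    hence "a * (sin r - sin p) > 0" by (simp add: right_diff_distrib)
    thus ?thesis using ord 2 rp' by linarith
  next
    case 3
    hence "2 * sin q < sin p + sin r" using assms by (intro simplex_max_decreases) auto
    hence "a * (2 * sin q - sin p - sin r) < 0" by (intro neg) simp
    thus ?thesis using ord 3 q' by linarith
  next
    case 4
    hence "sin p + sin r < 2 * sin q" using assms by (intro simplex_min_increases) auto
    hence "a * (2 * sin q - sin p - sin r) > 0" using a by (intro mult_pos_pos) auto
    thus ?thesis using ord 4 q' by linarith
  qed
qed

section \<open>The Lyapunov function on the region\<close>

lemma U_fun_proj:
  assumes "0 < y" "y < x" "x < 2 * pi"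
  shows "U_fun (torus_proj (x, y)) = \<bar>x - 2 * y\<bar> + \<bar>2 * pi + y - 2 * x\<bar>"
  using torus_coords_proj[of x y] assms by (simp add: U_fun_def)

lemma R_region_altdef:
  "R_region = torus_proj ` {u. 0 < snd u \<and> snd u < fst u \<and> fst u < 2 * pi}"
  unfolding R_region_def by (rule arg_cong[of _ _ "image torus_proj"]) auto

lemma open_triangle: "open {u :: real \<times> real. 0 < snd u \<and> snd u < fst u \<and> fst u < 2 * pi}"
  by (intro open_Collect_conj open_Collect_less continuous_intros)

lemma R_regionE:
  assumes "z \<in> R_region"
  obtains x y where "z = torus_proj (x, y)" "0 < y" "y < x" "x < 2 * pi"
  using assms by (auto simp: R_region_altdef)

lemma R_region_minus_H2E:
  assumes "z \<in> R_region - H2"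
  obtains x y where "z = torus_proj (x, y)" "0 < y" "y < x" "x < 2 * pi"
    "x \<noteq> 4 * pi / 3 \<or> y \<noteq> 2 * pi / 3"
  using assms by (metis DiffD1 DiffD2 H2_def R_regionE singletonI)

lemma H2_subset_R_region: "H2 \<subseteq> R_region"
  by (auto simp: H2_def R_region_altdef)

lemma continuous_on_U_fun: "continuous_on R_region U_fun"
  unfolding R_region_altdef
proof (rule continuous_on_torus_proj_image[OF open_triangle])
  have "continuous_on {u. 0 < snd u \<and> snd u < fst u \<and> fst u < 2 * pi}
      (\<lambda>u. \<bar>fst u - 2 * snd u\<bar> + \<bar>2 * pi + snd u - 2 * fst u\<bar>)"
    by (intro continuous_intros)
  thus "continuous_on {u. 0 < snd u \<and> snd u < fst u \<and> fst u < 2 * pi}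
      (\<lambda>u. U_fun (torus_proj u))"
    by (rule continuous_on_eq) (auto simp: U_fun_proj)
qed

lemma U_fun_H2: "U_fun (torus_proj (4 * pi / 3, 2 * pi / 3)) = 0"
  by (subst U_fun_proj) auto

lemma U_fun_pos:
  assumes "z \<in> R_region - H2"
  shows "U_fun z > 0"
proof -
  obtain x y where z: "z = torus_proj (x, y)" and xy: "0 < y" "y < x" "x < 2 * pi"
    and "x \<noteq> 4 * pi / 3 \<or> y \<noteq> 2 * pi / 3"
    using assms by (rule R_region_minus_H2E)
  hence "x - 2 * y \<noteq> 0 \<or> 2 * pi + y - 2 * x \<noteq> 0" by auto
  thus ?thesis unfolding z U_fun_proj[OF xy] by linarith
qed

lemma U_fun_decreases:
  assumes a: "0 < a" "a < 1/3" and z: "z \<in> R_region - H2"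
  shows "U_fun (G_map a z) < U_fun z"
proof -
  obtain x y where z_eq: "z = torus_proj (x, y)" and xy: "0 < y" "y < x" "x < 2 * pi"
    and ne: "x \<noteq> 4 * pi / 3 \<or> y \<noteq> 2 * pi / 3"
    using z by (rule R_region_minus_H2E)
  define X where "X = x + 2 * a * sin x + a * sin y + a * sin (x - y)"
  define Y where "Y = y + a * sin x + 2 * a * sin y + a * sin (y - x)"
  have G: "G_map a z = torus_proj (X, Y)"
    by (simp add: z_eq G_map.abs_eq G_lift_def X_def Y_def)
  define p q r where "p = y" and "q = x - y" and "r = 2 * pi - x"
  have sins: "sin r = - sin x" "sin (y - x) = - sin q" "sin (x - y) = sin q" "sin y = sin p"
    using sin_minus[of "x - y"] by (simp_all add: p_def q_def r_def sin_2pi_minus)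
  define p' q' r' where "p' = p + a * (2 * sin p - sin q - sin r)"
    and "q' = q + a * (2 * sin q - sin p - sin r)"
    and "r' = r + a * (2 * sin r - sin p - sin q)"
  have *: "\<bar>q' - p'\<bar> + \<bar>r' - q'\<bar> < \<bar>q - p\<bar> + \<bar>r - q\<bar>"
    unfolding p'_def q'_def r'_def using a xy ne
    by (intro simplex_step_decreases) (auto simp: p_def q_def r_def)
  have Y: "Y = p'" unfolding Y_def p'_def sins by (simp add: sins algebra_simps) (simp add: p_def)
  have X: "X = 2 * pi - r'"
    unfolding X_def r'_def sins by (simp add: algebra_simps) (simp add: r_def)
  have "p' + q' + r' = 2 * pi"
    by (simp add: p'_def q'_def r'_def algebra_simps) (simp add: p_def q_def r_def)
  hence q': "q' = X - Y" using X Y by linarith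
  \<comment> \<open>Positivity puts \<open>(X, Y)\<close> inside the triangle, so reduction modulo
    2\<pi> leaves it unchanged and the formula for \<open>U_fun\<close> applies directly.\<close>
  have pos: "0 < p'" "0 < q'" "0 < r'"
    using xy simplex_step_pos[OF a, of p q r] simplex_step_pos[OF a, of q p r]
      simplex_step_pos[OF a, of r p q]
    by (simp_all add: p'_def q'_def r'_def, simp_all add: p_def q_def r_def)
  have "U_fun (G_map a z) = \<bar>X - 2 * Y\<bar> + \<bar>2 * pi + Y - 2 * X\<bar>"
    unfolding G using pos X Y q' by (intro U_fun_proj) auto
  also have "\<dots> = \<bar>q' - p'\<bar> + \<bar>r' - q'\<bar>"
    using X Y q' by (simp add: algebra_simps)
  also note *
  also have "\<bar>q - p\<bar> + \<bar>r - q\<bar> = U_fun z"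
    unfolding z_eq U_fun_proj[OF xy] by (simp add: p_def q_def r_def algebra_simps)
  finally show ?thesis .
qed

lemma strict_lyapunov_U_fun:
  assumes a: "0 < a" "a < 1/3"
  shows "strict_lyapunov_function (G_map a) R_region H2 U_fun"
proof -
  have "orbital_derivative (G_map a) U_fun z < 0" if "z \<in> R_region - H2" for z
    using U_fun_decreases[OF a that] by (simp add: orbital_derivative_def)
  moreover have "orbital_derivative (G_map a) U_fun z = 0" if "z \<in> H2" for z
  proof -
    \<comment> \<open>With this relation all sine terms of the map cancel, so the point of
      \<open>H2\<close> is fixed.\<close>
    have "sin (4 * pi / 3) = - sin (2 * pi / 3)"
      using sin_2pi_minus[of "2 * pi / 3"] by (simp add: field_simps)
    hence "G_lift a (4 * pi / 3, 2 * pi / 3) = (4 * pi / 3, 2 * pi / 3)"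
      by (simp add: G_lift_def)
    thus ?thesis using that by (simp add: orbital_derivative_def H2_def G_map.abs_eq)
  qed
  ultimately have "orbital_derivative (G_map a) U_fun z \<le> 0" if "z \<in> R_region" for z
    using that by (cases "z \<in> H2") (auto intro: less_imp_le)
  moreover have "open R_region"
    unfolding R_region_altdef by (rule open_torus_proj_image[OF open_triangle])
  ultimately show ?thesis
    unfolding strict_lyapunov_function_def lyapunov_function_def
    using continuous_on_U_fun U_fun_pos H2_subset_R_region U_fun_H2
      \<open>\<And>z. z \<in> R_region - H2 \<Longrightarrow> orbital_derivative (G_map a) U_fun z < 0\<close>
    by (auto simp: H2_def)
qed

text \<open>At level 1 any two of the variables \<open>y\<close>, \<open>x - y\<close>,
  \<open>2 * pi - x\<close> differ by at most 1, while their sum exceeds 2, so all are positive. The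
  plane set cut out by the closed inequality alone therefore lies in the open triangle; it is
  compact, and its projection is the sublevel set.\<close>

lemma compact_U_fun_sublevel: "compact {z \<in> R_region. U_fun z \<le> 1}"
proof -
  let ?S = "{u. \<bar>fst u - 2 * snd u\<bar> + \<bar>2 * pi + snd u - 2 * fst u\<bar> \<le> (1 :: real)}"
  have tri: "0 < y \<and> y < x \<and> x < 2 * pi"
    if "\<bar>x - 2 * y\<bar> + \<bar>2 * pi + y - 2 * x\<bar> \<le> 1" for x y
    using that pi_gt3 by linarith
  have "closed ?S" by (intro closed_Collect_le continuous_intros)
  moreover have "?S \<subseteq> {0..2 * pi} \<times> {0..2 * pi}" using tri by fastforce
  hence "bounded ?S" by (rule bounded_subset[rotated]) (intro bounded_Times bounded_closed_interval)
  ultimately have "compact ?S" by (simp add: compact_eq_bounded_closed)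
  hence "compact (torus_proj ` ?S)"
    by (intro compact_continuous_image continuous_on_torus_proj)
  also have "torus_proj ` ?S = {z \<in> R_region. U_fun z \<le> 1}"
  proof (intro equalityI subsetI)
    fix z assume "z \<in> torus_proj ` ?S"
    then obtain x y where z: "z = torus_proj (x, y)"
        and xy: "\<bar>x - 2 * y\<bar> + \<bar>2 * pi + y - 2 * x\<bar> \<le> 1" by auto
    thus "z \<in> {z \<in> R_region. U_fun z \<le> 1}"
      using tri[OF xy] U_fun_proj[of y x] by (auto simp: R_region_altdef)
  next
    fix z assume "z \<in> {z \<in> R_region. U_fun z \<le> 1}"
    thus "z \<in> torus_proj ` ?S" by (auto elim!: R_regionE simp: U_fun_proj)
  qed
  finally show ?thesis .
qed

theorem theorem7:
  fixes a :: real
  assumes "0 < a" and "a < 1/3"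
  shows "strict_lyapunov_function (G_map a) R_region H2 U_fun
       \<and> asymptotically_stable (G_map a) H2"
  using strict_lyapunov_U_fun[OF assms]
    strict_lyapunov_imp_asymptotically_stable[OF strict_lyapunov_U_fun[OF assms]
      G_map_region[OF assms] continuous_on_G_map zero_less_one compact_U_fun_sublevel]
  by (rule conjI)

end
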